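(* Let $S$ be a local commutative semiring with $1\neq 0$ and let $M$ be a multiplication $S$-semimodule. If $N$ is a weakly $1$-absorbing prime subtractive subsemimodule of $M$ that is not $1$-absorbing prime, then $N^3=0$.
   Context: Semimodules are unital. A semiring is local if it has exactly one maximal ideal; equivalently, the sum of two nonunits is a nonunit. For a subsemimodule $N$ of $M$, $(N:_S M)=\{s\in S\mid sM\subseteq N\}$. A proper subsemimodule $N$ of $M$ is $1$-absorbing prime (respectively weakly $1$-absorbing prime) if for all nonunits $a,b\in S$ and all $m\in M$, $abm\in N$ (respectively $0\neq abm\in N$) implies $ab\in (N:_S M)$ or $m\in N$. $N$ is subtractive if for all $x,y\in M$, $x\in N$ and $x+y\in N$ imply $y\in N$. $M$ is a multiplication $S$-semimodule if for each subsemimodule $N$ of $M$ there is an ideal $I$ of $S$ with $N=IM$; in that case $N=(N:_S M)M$, and if $N=IM$ then $N^3=I^3M$ (independent of the choice of $I$), so $N^3=(N:_S M)^3M$. *)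

theory Defs
  imports Main
begin

section \<open>Ideals of commutative semirings\<close>

definition semiring_ideal :: "'s::comm_semiring_1 set \<Rightarrow> bool" where
  "semiring_ideal I \<longleftrightarrow>
     0 \<in> I \<and> (\<forall>a\<in>I. \<forall>b\<in>I. a + b \<in> I) \<and> (\<forall>s. \<forall>a\<in>I. s * a \<in> I)"

definition maximal_semiring_ideal :: "'s::comm_semiring_1 set \<Rightarrow> bool" where
  "maximal_semiring_ideal I \<longleftrightarrow>
     semiring_ideal I \<and> I \<noteq> UNIV \<and>
     (\<forall>J. semiring_ideal J \<longrightarrow> I \<subseteq> J \<longrightarrow> J = I \<or> J = UNIV)"

definition local_semiring :: "'s::comm_semiring_1 itself \<Rightarrow> bool" where
  "local_semiring _ \<longleftrightarrow> (\<exists>!I::'s set. maximal_semiring_ideal I)"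

definition ideal_mult :: "'s::comm_semiring_1 set \<Rightarrow> 's set \<Rightarrow> 's set" where
  "ideal_mult I J =
     {\<Sum>i<n. a i * b i | (n::nat) a b. \<forall>i<n. a i \<in> I \<and> b i \<in> J}"

primrec ideal_power :: "'s::comm_semiring_1 set \<Rightarrow> nat \<Rightarrow> 's set" where
  "ideal_power I 0 = UNIV"
| "ideal_power I (Suc k) = ideal_mult I (ideal_power I k)"


section \<open>Semimodules\<close>

definition subtractive :: "'m::comm_monoid_add set \<Rightarrow> bool" where
  "subtractive N \<longleftrightarrow> (\<forall>x y. x \<in> N \<longrightarrow> x + y \<in> N \<longrightarrow> y \<in> N)"

locale semimodule =
  fixes scale :: "'s::comm_semiring_1 \<Rightarrow> 'm::comm_monoid_add \<Rightarrow> 'm" (infixr \<open>*s\<close> 75)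
  assumes scale_add_right: "a *s (x + y) = a *s x + a *s y"
    and scale_add_left: "(a + b) *s x = a *s x + b *s x"
    and scale_scale: "a *s (b *s x) = (a * b) *s x"
    and scale_one: "1 *s x = x"
    and scale_zero_left: "0 *s x = 0"
    and scale_zero_right: "a *s 0 = 0"
begin

definition subsemimodule :: "'m set \<Rightarrow> bool" where
  "subsemimodule N \<longleftrightarrow>
     0 \<in> N \<and> (\<forall>x\<in>N. \<forall>y\<in>N. x + y \<in> N) \<and> (\<forall>s. \<forall>x\<in>N. s *s x \<in> N)"

definition residual :: "'m set \<Rightarrow> 's set" where
  "residual N = {s. \<forall>x. s *s x \<in> N}"

text \<open>A nonunit of the semiring is an element that does not divide \<open>1\<close>.\<close>

definition one_absorbing_prime :: "'m set \<Rightarrow> bool" where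
  "one_absorbing_prime N \<longleftrightarrow>
     subsemimodule N \<and> N \<noteq> UNIV \<and>
     (\<forall>a b x. \<not> a dvd 1 \<longrightarrow> \<not> b dvd 1 \<longrightarrow> (a * b) *s x \<in> N \<longrightarrow>
        a * b \<in> residual N \<or> x \<in> N)"

definition weakly_one_absorbing_prime :: "'m set \<Rightarrow> bool" where
  "weakly_one_absorbing_prime N \<longleftrightarrow>
     subsemimodule N \<and> N \<noteq> UNIV \<and>
     (\<forall>a b x. \<not> a dvd 1 \<longrightarrow> \<not> b dvd 1 \<longrightarrow> (a * b) *s x \<noteq> 0 \<longrightarrow> (a * b) *s x \<in> N \<longrightarrow>
        a * b \<in> residual N \<or> x \<in> N)"

definition ideal_smult :: "'s set \<Rightarrow> 'm set \<Rightarrow> 'm set" where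
  "ideal_smult I N =
     {\<Sum>i<n. a i *s x i | (n::nat) a x. \<forall>i<n. a i \<in> I \<and> x i \<in> N}"

definition multiplication_semimodule :: bool where
  "multiplication_semimodule \<longleftrightarrow>
     (\<forall>N. subsemimodule N \<longrightarrow> (\<exists>I. semiring_ideal I \<and> N = ideal_smult I UNIV))"

text \<open>
  If \<open>N = I M\<close> for an ideal \<open>I\<close>, then \<open>N\<^sup>k = I\<^sup>k M\<close>; this does not depend on the choice of
  \<open>I\<close> (lemma \<open>subsemimodule_power_eq\<close> below). The value is unspecified if \<open>N\<close> is not of the
  form \<open>I M\<close>, which cannot happen for a subsemimodule of a multiplication semimodule.
\<close>

definition subsemimodule_power :: "'m set \<Rightarrow> nat \<Rightarrow> 'm set" where
  "subsemimodule_power N k =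
     (THE P. \<exists>I. semiring_ideal I \<and> N = ideal_smult I UNIV \<and>
        P = ideal_smult (ideal_power I k) UNIV)"

lemma ideal_smultI:
  assumes "a \<in> I" "x \<in> N"
  shows "a *s x \<in> ideal_smult I N"
  unfolding ideal_smult_def using assms
  by (intro CollectI exI[of _ 1] exI[of _ "\<lambda>_. a"] exI[of _ "\<lambda>_. x"]) simp

lemma ideal_smult_zero: "0 \<in> ideal_smult I N"
  unfolding ideal_smult_def
  by (intro CollectI exI[of _ 0]) simp

lemma ideal_smult_add:
  assumes "u \<in> ideal_smult I N" "v \<in> ideal_smult I N"
  shows "u + v \<in> ideal_smult I N"
proof -
  obtain n a x where u: "u = (\<Sum>i<n. a i *s x i)" "\<forall>i<(n::nat). a i \<in> I \<and> x i \<in> N"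
    using assms(1) unfolding ideal_smult_def by blast
  obtain m b y where v: "v = (\<Sum>i<m. b i *s y i)" "\<forall>i<(m::nat). b i \<in> I \<and> y i \<in> N"
    using assms(2) unfolding ideal_smult_def by blast
  define c where "c i = (if i < n then a i else b (i - n))" for i
  define z where "z i = (if i < n then x i else y (i - n))" for i
  have "(\<Sum>i<n + k. c i *s z i) = u + (\<Sum>i<k. b i *s y i)" for k
    by (induction k) (simp_all add: u c_def z_def add.assoc)
  moreover have "\<forall>i<n + m. c i \<in> I \<and> z i \<in> N"
    using u(2) v(2) by (auto simp: c_def z_def)
  ultimately show ?thesis
    unfolding ideal_smult_def
    by (intro CollectI exI[of _ "n + m"] exI[of _ c] exI[of _ z]) (simp add: v)
qed

lemma ideal_smult_subsetI:
  assumes "0 \<in> P" "\<And>u v. u \<in> P \<Longrightarrow> v \<in> P \<Longrightarrow> u + v \<in> P"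
    and "\<And>a x. a \<in> I \<Longrightarrow> x \<in> N \<Longrightarrow> a *s x \<in> P"
  shows "ideal_smult I N \<subseteq> P"
proof
  fix u assume "u \<in> ideal_smult I N"
  then obtain n a x where u: "u = (\<Sum>i<n. a i *s x i)" "\<forall>i<(n::nat). a i \<in> I \<and> x i \<in> N"
    unfolding ideal_smult_def by blast
  have "k \<le> n \<Longrightarrow> (\<Sum>i<k. a i *s x i) \<in> P" for k
    by (induction k) (auto simp: u(2) intro!: assms)
  then show "u \<in> P" by (simp add: u)
qed

end

lemma semimodule_self: "semimodule ((*) :: 's::comm_semiring_1 \<Rightarrow> 's \<Rightarrow> 's)"
  by standard (simp_all add: algebra_simps)

lemma ideal_mult_eq_ideal_smult: "ideal_mult I J = semimodule.ideal_smult (*) I J"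
  unfolding ideal_mult_def semimodule.ideal_smult_def[OF semimodule_self] ..

context semimodule
begin

lemma ideal_smult_ideal_mult:
  "ideal_smult (ideal_mult I J) N = ideal_smult I (ideal_smult J N)"
proof (rule subset_antisym)
  show "ideal_smult (ideal_mult I J) N \<subseteq> ideal_smult I (ideal_smult J N)"
  proof (rule ideal_smult_subsetI[OF ideal_smult_zero ideal_smult_add])
    fix c x assume c: "c \<in> ideal_mult I J" and x: "x \<in> N"
    have "ideal_mult I J \<subseteq> {c. c *s x \<in> ideal_smult I (ideal_smult J N)}"
      unfolding ideal_mult_eq_ideal_smult
      by (rule semimodule.ideal_smult_subsetI[OF semimodule_self])
         (auto simp: scale_zero_left scale_add_left scale_scale[symmetric]
            intro: ideal_smult_zero ideal_smult_add intro!: ideal_smultI x)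
    with c show "c *s x \<in> ideal_smult I (ideal_smult J N)" by blast
  qed
  show "ideal_smult I (ideal_smult J N) \<subseteq> ideal_smult (ideal_mult I J) N"
  proof (rule ideal_smult_subsetI[OF ideal_smult_zero ideal_smult_add])
    fix a u assume a: "a \<in> I" and u: "u \<in> ideal_smult J N"
    have "ideal_smult J N \<subseteq> {u. a *s u \<in> ideal_smult (ideal_mult I J) N}"
    proof (rule ideal_smult_subsetI; clarsimp simp: scale_zero_right scale_add_right
        ideal_smult_zero ideal_smult_add)
      fix b x assume "b \<in> J" "x \<in> N"
      then show "a *s b *s x \<in> ideal_smult (ideal_mult I J) N"
        unfolding scale_scale ideal_mult_eq_ideal_smult
        by (intro ideal_smultI semimodule.ideal_smultI[OF semimodule_self] a)
    qed
    with u show "a *s u \<in> ideal_smult (ideal_mult I J) N" by blast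
  qed
qed

lemma ideal_mult_commute: "ideal_mult I J = ideal_mult J (I :: 's set)"
proof -
  have "ideal_mult I J \<subseteq> ideal_mult J I" for I J :: "'s set"
  proof
    fix u assume "u \<in> ideal_mult I J"
    then obtain n a b where "u = (\<Sum>i<n. a i * b i)" "\<forall>i<(n::nat). a i \<in> I \<and> b i \<in> J"
      unfolding ideal_mult_def by blast
    then show "u \<in> ideal_mult J I"
      unfolding ideal_mult_def
      by (intro CollectI exI[of _ n] exI[of _ b] exI[of _ a]) (simp add: mult.commute)
  qed
  then show ?thesis by blast
qed

lemma ideal_smult_left_commute:
  "ideal_smult I (ideal_smult J N) = ideal_smult J (ideal_smult I N)"
  by (metis ideal_smult_ideal_mult ideal_mult_commute)

lemma ideal_smult_power_cong:
  assumes "ideal_smult I UNIV = ideal_smult J UNIV"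
  shows "ideal_smult (ideal_power I k) UNIV = ideal_smult (ideal_power J k) UNIV"
proof (induction k)
  case (Suc k)
  then show ?case
    by (simp add: ideal_smult_ideal_mult)
       (metis assms ideal_smult_left_commute)
qed simp

lemma subsemimodule_power_eq:
  assumes "semiring_ideal I" "N = ideal_smult I UNIV"
  shows "subsemimodule_power N k = ideal_smult (ideal_power I k) UNIV"
  unfolding subsemimodule_power_def
proof (rule the_equality)
  show "\<exists>I'. semiring_ideal I' \<and> N = ideal_smult I' UNIV \<and>
      ideal_smult (ideal_power I k) UNIV = ideal_smult (ideal_power I' k) UNIV"
    using assms by blast
next
  fix P
  assume "\<exists>I'. semiring_ideal I' \<and> N = ideal_smult I' UNIV \<and>
      P = ideal_smult (ideal_power I' k) UNIV"
  then show "P = ideal_smult (ideal_power I k) UNIV"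
    using assms(2) ideal_smult_power_cong by metis
qed

end

end

theory Submission
  imports Defs
begin

text \<open>
  Failure of the \<open>1\<close>-absorbing prime condition gives nonunits \<open>a\<close>, \<open>b\<close> and a vector \<open>m\<close> with
  \<open>abm \<in> N\<close>, \<open>ab \<notin> P\<close> and \<open>m \<notin> N\<close>, where \<open>P = (N : M)\<close>; the weak condition then forces
  \<open>abm = 0\<close>. The idea is that such a triple can be perturbed: for \<open>p, q \<in> P\<close> and \<open>n \<in> N\<close>, the
  triple \<open>(a + p, b + q, m + n)\<close> violates the condition in the same way. Its scalars are nonunits
  because the semiring is local and the elements of \<open>P\<close> are nonunits, and it stays outside \<open>P\<close>
  and \<open>N\<close> because both are subtractive. Hence \<open>(a + p)(b + q)(m + n) = 0\<close> for all these
  \<open>p, q, n\<close> (lemma \<open>perturbed_violation_zero\<close>). Expanding this product and removing its eight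
  terms one after the other leaves \<open>pqn = 0\<close>, so \<open>P\<^sup>2 N = 0\<close>
  (lemma \<open>residual_residual_annihilates\<close>). If \<open>N = IM\<close>, then \<open>I \<subseteq> P\<close> and
  \<open>N\<^sup>3 = I\<^sup>3 M \<subseteq> I\<^sup>2 N\<close>, which is therefore zero.
\<close>

section \<open>Nonunits of a local semiring\<close>

lemma semiring_ideal_principal: "semiring_ideal {s * a | s. True}"
  for a :: "'s::comm_semiring_1"
  unfolding semiring_ideal_def
proof (intro conjI ballI allI)
  have "0 * a \<in> {s * a | s. True}"
    by blast
  then show "0 \<in> {s * a | s. True}"
    by simp
next
  fix x y assume "x \<in> {s * a | s. True}" "y \<in> {s * a | s. True}"
  then obtain s t where "x = s * a" "y = t * a" by blast
  then have "x + y = (s + t) * a"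
    by (simp add: distrib_right)
  then show "x + y \<in> {s * a | s. True}"
    by blast
next
  fix r x assume "x \<in> {s * a | s. True}"
  then obtain s where "x = s * a" by blast
  then have "r * x = (r * s) * a"
    by (simp add: mult.assoc)
  then show "r * x \<in> {s * a | s. True}"
    by blast
qed

lemma semiring_ideal_eq_UNIV_iff:
  assumes "semiring_ideal I"
  shows "I = UNIV \<longleftrightarrow> 1 \<in> I"
proof
  assume "1 \<in> I"
  with assms have "s * 1 \<in> I" for s
    unfolding semiring_ideal_def by blast
  then show "I = UNIV" by auto
qed simp

lemma semiring_ideal_Union_chain:
  assumes "subset.chain {I. semiring_ideal I} C" "C \<noteq> {}"
  shows "semiring_ideal (\<Union>C)"
  unfolding semiring_ideal_def
proof (intro conjI ballI allI)
  have ideals: "semiring_ideal I" if "I \<in> C" for I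
    using assms(1) that by (auto simp: subset_chain_def)
  show "0 \<in> \<Union>C"
    using ideals assms(2) by (meson UnionI ex_in_conv semiring_ideal_def)
  show "x + y \<in> \<Union>C" if xy: "x \<in> \<Union>C" "y \<in> \<Union>C" for x y
  proof -
    obtain I J where IJ: "I \<in> C" "J \<in> C" "x \<in> I" "y \<in> J"
      using xy by blast
    then have "I \<subseteq> J \<or> J \<subseteq> I"
      using assms(1) by (auto simp: subset_chain_def)
    then obtain K where K: "K \<in> C" "x \<in> K" "y \<in> K"
      using IJ by blast
    then have "x + y \<in> K"
      using ideals[OF K(1)] by (simp add: semiring_ideal_def)
    with K(1) show ?thesis by blast
  qed
  show "s * x \<in> \<Union>C" if x: "x \<in> \<Union>C" for s x
  proof -
    obtain I where I: "I \<in> C" "x \<in> I"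
      using x by blast
    then have "s * x \<in> I"
      using ideals[OF I(1)] by (simp add: semiring_ideal_def)
    with I(1) show ?thesis by blast
  qed
qed

text \<open>
  An ideal is proper exactly if it omits \<open>1\<close>, and this survives unions of chains. So Zorn's
  lemma applies to the proper ideals containing \<open>a\<close>; the principal ideal of \<open>a\<close> is one of them
  because \<open>a\<close> does not divide \<open>1\<close>.
\<close>

lemma nonunit_in_maximal_semiring_ideal:
  fixes a :: "'s::comm_semiring_1"
  assumes "\<not> a dvd 1"
  obtains I where "maximal_semiring_ideal I" "a \<in> I"
proof -
  define A where "A = {I :: 's set. semiring_ideal I \<and> 1 \<notin> I \<and> a \<in> I}"
  have "{s * a | s. True} \<in> A"
  proof -
    have "1 \<notin> {s * a | s. True}"
    proof
      assume "1 \<in> {s * a | s. True}"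
      then obtain s where "1 = s * a" by blast
      then have "a dvd 1" by (metis dvd_triv_right)
      with assms show False by contradiction
    qed
    moreover have "1 * a \<in> {s * a | s. True}"
      by blast
    ultimately show ?thesis
      using semiring_ideal_principal[of a] unfolding A_def mult_1_left by blast
  qed
  moreover have "\<Union>C \<in> A" if "C \<noteq> {}" "subset.chain A C" for C
  proof -
    have "subset.chain {I. semiring_ideal I} C"
      using that(2) unfolding subset_chain_def A_def by blast
    then have "semiring_ideal (\<Union>C)"
      using that(1) by (rule semiring_ideal_Union_chain)
    with that show ?thesis
      unfolding A_def subset_chain_def by blast
  qed
  ultimately obtain I where I: "I \<in> A" "\<forall>X\<in>A. I \<subseteq> X \<longrightarrow> X = I"
    using subset_Zorn_nonempty[of A] by blast
  have "maximal_semiring_ideal I"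
    unfolding maximal_semiring_ideal_def
  proof (intro conjI allI impI)
    show "semiring_ideal I" "I \<noteq> UNIV"
      using I(1) unfolding A_def by blast+
    fix J assume J: "semiring_ideal J" "I \<subseteq> J"
    show "J = I \<or> J = UNIV"
    proof (cases "1 \<in> J")
      case True
      with J(1) show ?thesis by (simp add: semiring_ideal_eq_UNIV_iff)
    next
      case False
      with J I(1) have "J \<in> A" unfolding A_def by blast
      with J(2) I(2) show ?thesis by blast
    qed
  qed
  moreover have "a \<in> I"
    using I(1) by (simp add: A_def)
  ultimately show ?thesis by (rule that)
qed

text \<open>
  Two nonunits both lie in the unique maximal ideal, hence so does their sum, and a proper
  ideal contains no units.
\<close>

lemma local_semiring_nonunit_add:
  fixes a b :: "'s::comm_semiring_1"
  assumes "local_semiring TYPE('s)" "\<not> a dvd 1" "\<not> b dvd 1"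
  shows "\<not> a + b dvd 1"
proof
  assume "a + b dvd 1"
  then obtain c where c: "1 = c * (a + b)"
    by (metis dvdE mult.commute)
  obtain I where I: "maximal_semiring_ideal I" "a \<in> I"
    using assms(2) by (rule nonunit_in_maximal_semiring_ideal)
  obtain J where J: "maximal_semiring_ideal J" "b \<in> J"
    using assms(3) by (rule nonunit_in_maximal_semiring_ideal)
  have "J = I"
    using assms(1) J(1) I(1) unfolding local_semiring_def by (elim ex1E) metis
  then have "c * (a + b) \<in> I"
    using I J(2) by (simp add: maximal_semiring_ideal_def semiring_ideal_def)
  moreover have "1 \<notin> I"
    using I(1) semiring_ideal_eq_UNIV_iff[of I] by (simp add: maximal_semiring_ideal_def)
  ultimately show False
    unfolding c[symmetric] by contradiction
qed


section \<open>The residual of a subsemimodule\<close>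

context semimodule
begin

lemma residual_nonunit:
  assumes "subsemimodule N" "N \<noteq> UNIV" "p \<in> residual N"
  shows "\<not> p dvd 1"
proof
  assume "p dvd 1"
  then obtain c where c: "1 = p * c" by (rule dvdE)
  have "x \<in> N" for x
  proof -
    have "x = p *s (c *s x)"
      by (simp add: scale_scale scale_one flip: c)
    then show ?thesis
      using assms(3) unfolding residual_def by (metis mem_Collect_eq)
  qed
  with assms(2) show False by blast
qed

lemma residual_zero: "subsemimodule N \<Longrightarrow> 0 \<in> residual N"
  by (simp add: residual_def subsemimodule_def scale_zero_left)

lemma residual_add:
  "subsemimodule N \<Longrightarrow> p \<in> residual N \<Longrightarrow> q \<in> residual N \<Longrightarrow> p + q \<in> residual N"
  by (simp add: residual_def subsemimodule_def scale_add_left)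

lemma residual_mult_left:
  "subsemimodule N \<Longrightarrow> p \<in> residual N \<Longrightarrow> s * p \<in> residual N"
  by (simp add: residual_def subsemimodule_def flip: scale_scale)

lemma residual_mult_right:
  "p \<in> residual N \<Longrightarrow> p * s \<in> residual N"
  by (simp add: residual_def flip: scale_scale)

lemma subtractive_residual: "subtractive N \<Longrightarrow> subtractive (residual N)"
  unfolding subtractive_def residual_def mem_Collect_eq scale_add_left by blast


section \<open>Perturbing a violation of the absorbing condition\<close>

text \<open>
  The perturbed triple again violates the \<open>1\<close>-absorbing prime condition, and the weak condition
  tolerates a violation only if the product is zero.
\<close>

lemma perturbed_violation_zero:
  assumes local: "local_semiring TYPE('s)"
    and weak: "weakly_one_absorbing_prime N"
    and subtr: "subtractive N"
    and nonunits: "\<not> a dvd 1" "\<not> b dvd 1"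
    and violation: "(a * b) *s m \<in> N" "a * b \<notin> residual N" "m \<notin> N"
    and mem: "p \<in> residual N" "q \<in> residual N" "n \<in> N"
  shows "((a + p) * (b + q)) *s (m + n) = 0"
proof -
  have sub: "subsemimodule N" and proper: "N \<noteq> UNIV"
    using weak by (auto simp: weakly_one_absorbing_prime_def)
  define r where "r = a * q + p * b + p * q"
  have r: "r \<in> residual N"
    unfolding r_def using sub mem
    by (intro residual_add residual_mult_left residual_mult_right)
  have expand: "(a + p) * (b + q) = r + a * b"
    by (simp add: r_def algebra_simps)
  have "\<not> a + p dvd 1" "\<not> b + q dvd 1"
    using local nonunits residual_nonunit[OF sub proper] mem
    by (simp_all add: local_semiring_nonunit_add)
  moreover have "(a + p) * (b + q) \<notin> residual N"
    using subtractive_residual[OF subtr] r violation(2)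
    unfolding expand subtractive_def by blast
  moreover have "m + n \<notin> N"
    using subtr violation(3) mem(3) unfolding subtractive_def by (metis add.commute)
  moreover have "((a + p) * (b + q)) *s (m + n) \<in> N"
  proof -
    have "r *s (m + n) \<in> N"
      using r by (simp add: residual_def)
    moreover have "(a * b) *s n \<in> N"
      using sub mem(3) by (simp add: subsemimodule_def)
    ultimately show ?thesis
      using sub violation(1)
      unfolding expand scale_add_left scale_add_right[of "a * b"] subsemimodule_def by blast
  qed
  ultimately show ?thesis
    using weak unfolding weakly_one_absorbing_prime_def by blast
qed

text \<open>
  The perturbations may vanish, so the terms of the expanded product can be isolated by
  increasing number of perturbed factors. This replaces the subtraction that a commutative monoid
  does not offer: each step adds one new term to a sum whose other terms are already zero.
\<close>

lemma residual_residual_annihilates: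
  assumes local: "local_semiring TYPE('s)"
    and weak: "weakly_one_absorbing_prime N"
    and subtr: "subtractive N"
    and not_prime: "\<not> one_absorbing_prime N"
    and mem: "p \<in> residual N" "q \<in> residual N" "n \<in> N"
  shows "(p * q) *s n = 0"
proof -
  have sub: "subsemimodule N"
    using weak by (auto simp: weakly_one_absorbing_prime_def)
  obtain a b m where nonunits: "\<not> a dvd 1" "\<not> b dvd 1"
    and violation: "(a * b) *s m \<in> N" "a * b \<notin> residual N" "m \<notin> N"
    using weak not_prime
    unfolding weakly_one_absorbing_prime_def one_absorbing_prime_def by blast
  have zero: "((a + p') * (b + q')) *s (m + n') = 0"
    if "p' \<in> residual N" "q' \<in> residual N" "n' \<in> N" for p' q' n'
    using perturbed_violation_zero[OF local weak subtr nonunits violation that] .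
  have 0: "0 \<in> residual N" "0 \<in> N"
    using sub residual_zero by (auto simp: subsemimodule_def)
  note expand = distrib_left distrib_right scale_add_left scale_add_right
  have abm: "(a * b) *s m = 0"
    using zero[OF 0(1) 0(1) 0(2)] by simp
  have abn: "(a * b) *s n = 0"
    using zero[OF 0(1) 0(1) mem(3)] by (simp add: expand abm)
  have aqm: "(a * q) *s m = 0"
    using zero[OF 0(1) mem(2) 0(2)] by (simp add: expand abm)
  have pbm: "(p * b) *s m = 0"
    using zero[OF mem(1) 0(1) 0(2)] by (simp add: expand abm)
  have aqn: "(a * q) *s n = 0"
    using zero[OF 0(1) mem(2) mem(3)] by (simp add: expand abm abn aqm)
  have pbn: "(p * b) *s n = 0"
    using zero[OF mem(1) 0(1) mem(3)] by (simp add: expand abm abn pbm)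
  have pqm: "(p * q) *s m = 0"
    using zero[OF mem(1) mem(2) 0(2)] by (simp add: expand abm aqm pbm)
  show ?thesis
    using zero[OF mem] by (simp add: expand abm abn aqm pbm aqn pbn pqm)
qed


section \<open>The cube of the subsemimodule\<close>

lemma subsemimodule_cube_zero:
  assumes mult: "multiplication_semimodule" and sub: "subsemimodule N"
    and annihilates: "\<And>p q n. p \<in> residual N \<Longrightarrow> q \<in> residual N \<Longrightarrow> n \<in> N \<Longrightarrow> (p * q) *s n = 0"
  shows "subsemimodule_power N 3 = {0}"
proof -
  obtain I where I: "semiring_ideal I" "N = ideal_smult I UNIV"
    using mult sub unfolding multiplication_semimodule_def by blast
  have residual: "I \<subseteq> residual N"
    by (auto simp: residual_def I(2) intro: ideal_smultI)
  have "subsemimodule_power N 3 = ideal_smult (ideal_power I 3) UNIV"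
    using I by (rule subsemimodule_power_eq)
  \<comment> \<open>The factor \<open>UNIV\<close> is the zeroth power of \<open>I\<close>, moved to the left of \<open>N = IM\<close>.\<close>
  also have "\<dots> = ideal_smult I (ideal_smult I (ideal_smult UNIV N))"
    by (simp add: numeral_3_eq_3 ideal_smult_ideal_mult ideal_smult_left_commute[of I UNIV]
        flip: I(2))
  finally have cube:
    "subsemimodule_power N 3 = ideal_smult I (ideal_smult I (ideal_smult UNIV N))" .
  have "ideal_smult UNIV N \<subseteq> N"
    using sub by (intro ideal_smult_subsetI) (auto simp: subsemimodule_def)
  then have "ideal_smult I (ideal_smult UNIV N) \<subseteq> {y. \<forall>p\<in>I. p *s y = 0}"
    using residual annihilates
    by (intro ideal_smult_subsetI)
       (auto simp: scale_zero_right scale_add_right scale_scale subset_iff)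
  then have "subsemimodule_power N 3 \<subseteq> {0}"
    unfolding cube by (intro ideal_smult_subsetI) auto
  moreover have "0 \<in> subsemimodule_power N 3"
    unfolding cube by (rule ideal_smult_zero)
  ultimately show ?thesis by blast
qed

end

theorem corollary3p17:
  fixes scale :: "'s::comm_semiring_1 \<Rightarrow> 'm::comm_monoid_add \<Rightarrow> 'm"
    and N :: "'m set"
  assumes "local_semiring TYPE('s)"
    and "semimodule scale"
    and "semimodule.multiplication_semimodule scale"
    and "semimodule.weakly_one_absorbing_prime scale N"
    and "subtractive N"
    and "\<not> semimodule.one_absorbing_prime scale N"
  shows "semimodule.subsemimodule_power scale N 3 = {0}"
proof -
  interpret semimodule scale by fact
  have "subsemimodule N"
    using assms(4) by (simp add: weakly_one_absorbing_prime_def)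
  with assms(3) show ?thesis
    by (rule subsemimodule_cube_zero)
       (rule residual_residual_annihilates[OF assms(1,4-6)])
qed

end
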